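(* Let $p>1$ be an integer and let $u^{(p)}$ be the fixed point of the substitution $\varphi_p(L)=L^pS$, $\varphi_p(S)=M$, $\varphi_p(M)=L^{p-1}S$. Let $v,w$ be factors of $u^{(p)}$ with $|v|=|w|$. Then $\left||v|_M-|w|_M\right|\le 2$.
   Context: $u^{(p)}=\lim_{n\to\infty}\varphi_p^n(L)$ is the unique infinite word over $\{L,S,M\}$ fixed by $\varphi_p$. A factor is a finite contiguous subword; $|w|$ is the length and $|w|_a$ the number of occurrences of the letter $a$ in $w$. *)

theory Defs
  imports Main
begin

datatype letter = L | S | M

fun phi :: "nat \<Rightarrow> letter \<Rightarrow> letter list" where
  "phi p L = replicate p L @ [S]"
| "phi p S = [M]"
| "phi p M = replicate (p - 1) L @ [S]"

definition phi_word :: "nat \<Rightarrow> letter list \<Rightarrow> letter list" where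
  "phi_word p w = concat (map (phi p) w)"

text \<open>The fixed point u^(p) = lim phi_p^n(L), as an infinite word nat => letter.
  For p >= 2, phi_p^n(L) is a prefix of phi_p^(n+1)(L) and has length > n,
  so the i-th letter of the limit is the i-th letter of phi_p^(i+1)(L).\<close>
definition u :: "nat \<Rightarrow> nat \<Rightarrow> letter" where
  "u p i = ((phi_word p ^^ Suc i) [L]) ! i"

definition is_factor :: "nat \<Rightarrow> letter list \<Rightarrow> bool" where
  "is_factor p w \<longleftrightarrow> (\<exists>k. w = map (u p) [k..<k + length w])"

definition count_letter :: "letter list \<Rightarrow> letter \<Rightarrow> nat" where
  "count_letter w a = length (filter (\<lambda>x. x = a) w)"

end

theory Submission
  imports Defs Complex_Main
begin

text \<open>
  For prefixes of lengths \<open>n1\<close>, \<open>n2\<close>, \<open>n3\<close>, \<open>n4\<close> of the fixed point with \<open>n1 + n2 = n3 + n4\<close>, the claim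
  says that the numbers of letters \<open>M\<close> satisfy \<open>M(n1) + M(n2) \<le> M(n3) + M(n4) + 2\<close>.  Every prefix
  is \<open>phi(Q) L^j\<close> for a shorter prefix \<open>Q\<close>, and the incidence matrix \<open>A\<close> of the substitution has
  characteristic polynomial \<open>x^3 - p x^2 - x + 1\<close>, with one root \<open>1 / b > p\<close> and two roots of
  modulus less than 1 and opposite signs.  A linear functional \<open>g\<close> that vanishes on the letter
  frequencies is governed by the numbers \<open>c i = (-1)^i g(A^i e_L)\<close>, which satisfy
  \<open>c (i+2) = (b - b^2) c (i+1) + b c i\<close> with positive coefficients; if both \<open>c\<close> and
  \<open>c i - c (i+2)\<close> are eventually nonnegative, desubstitution gives sharp bounds for \<open>g\<close> on all
  prefixes, depending on the letter that follows.

  For \<open>p \<ge> 3\<close> the discrepancy functional of the letter \<open>M\<close> has oscillation less than \<open>3/2\<close>,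
  which is enough.  For \<open>p = 2\<close> its oscillation exceeds \<open>3/2\<close>.  There, quadruples of prefixes are
  desubstituted simultaneously: the bounds for two functionals leave only finitely many
  configurations that could be ancestors of a violation, and the quadruple of empty
  prefixes is not among them.
\<close>

section \<open>Desubstitution of prefixes\<close>

lemma phi_word_Nil [simp]: "phi_word p [] = []"
  by (simp add: phi_word_def)

lemma phi_word_append [simp]: "phi_word p (v @ w) = phi_word p v @ phi_word p w"
  by (simp add: phi_word_def)

lemma phi_word_singleton [simp]: "phi_word p [a] = phi p a"
  by (simp add: phi_word_def)

lemma count_letter_append [simp]:
  "count_letter (v @ w) a = count_letter v a + count_letter w a"
  by (simp add: count_letter_def)

lemma count_letter_Nil [simp]: "count_letter [] a = 0"
  by (simp add: count_letter_def)

lemma count_letter_Cons [simp]: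
  "count_letter (x # w) a = (if x = a then 1 else 0) + count_letter w a"
  by (simp add: count_letter_def)

lemma count_letter_replicate [simp]:
  "count_letter (replicate k x) a = (if x = a then k else 0)"
  by (induction k) auto

lemma count_letter_phi_word:
  "count_letter (phi_word p w) L = p * count_letter w L + (p - 1) * count_letter w M"
  "count_letter (phi_word p w) S = count_letter w L + count_letter w M"
  "count_letter (phi_word p w) M = count_letter w S"
proof (induction w)
  case (Cons a w)
  have "phi_word p (a # w) = phi p a @ phi_word p w" by (simp add: phi_word_def)
  with Cons show
    "count_letter (phi_word p (a # w)) L = p * count_letter (a # w) L + (p - 1) * count_letter (a # w) M"
    "count_letter (phi_word p (a # w)) S = count_letter (a # w) L + count_letter (a # w) M"
    "count_letter (phi_word p (a # w)) M = count_letter (a # w) S"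
    by (cases a; simp)+
qed simp_all

lemma length_eq_count_letters:
  "length w = count_letter w L + count_letter w S + count_letter w M"
proof (induction w)
  case (Cons a w)
  then show ?case by (cases a) auto
qed simp

lemma phi_nonempty: "phi p a \<noteq> []"
  by (cases a) auto

lemma length_phi_word_ge: "length w \<le> length (phi_word p w)"
proof (induction w)
  case (Cons a w)
  have "phi_word p (a # w) = phi p a @ phi_word p w" by (simp add: phi_word_def)
  moreover have "length (phi p a) \<ge> 1" using phi_nonempty[of p a] by (cases "phi p a") auto
  ultimately show ?case using Cons by simp
qed simp

section \<open>Iterates of the substitution and prefixes of the fixed point\<close>

definition iterate_word :: "nat \<Rightarrow> nat \<Rightarrow> letter list" where
  "iterate_word p k = (phi_word p ^^ k) [L]"

lemma iterate_word_Suc: "iterate_word p (Suc k) = phi_word p (iterate_word p k)"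
  by (simp add: iterate_word_def)

lemma iterate_word_grows:
  assumes "p > 1"
  shows "\<exists>w. w \<noteq> [] \<and> iterate_word p (Suc k) = iterate_word p k @ w"
proof (induction k)
  case 0
  have "replicate p L = L # replicate (p - 1) L" using assms by (cases p) auto
  then show ?case by (simp add: iterate_word_def)
next
  case (Suc k)
  then obtain w where w: "w \<noteq> []" "iterate_word p (Suc k) = iterate_word p k @ w" by blast
  have "phi_word p w \<noteq> []" using w(1) length_phi_word_ge[of w p] by auto
  moreover have "iterate_word p (Suc (Suc k)) = iterate_word p (Suc k) @ phi_word p w"
    using w(2) by (metis iterate_word_Suc phi_word_append)
  ultimately show ?case by blast
qed

lemma iterate_word_prefix:
  assumes "p > 1" "k \<le> l"
  shows "\<exists>w. iterate_word p l = iterate_word p k @ w"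
  using assms(2)
proof (induction l rule: dec_induct)
  case (step l)
  then show ?case using iterate_word_grows[OF assms(1), of l] by (metis append.assoc)
qed simp

lemma length_iterate_word:
  assumes "p > 1" shows "k < length (iterate_word p k)"
proof (induction k)
  case (Suc k)
  obtain w where "w \<noteq> []" "iterate_word p (Suc k) = iterate_word p k @ w"
    using iterate_word_grows[OF assms] by blast
  then show ?case using Suc by (cases w) auto
qed (simp add: iterate_word_def)

lemma u_eq_iterate_word:
  assumes "p > 1" "i < length (iterate_word p k)"
  shows "u p i = iterate_word p k ! i"
proof -
  have i: "i < length (iterate_word p (Suc i))"
    using length_iterate_word[OF assms(1), of "Suc i"] by simp
  have u: "u p i = iterate_word p (Suc i) ! i" by (simp add: u_def iterate_word_def)
  show ?thesis
  proof (cases "k \<le> Suc i")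
    case True
    with assms show ?thesis using iterate_word_prefix[OF assms(1) True] u by (auto simp: nth_append)
  next
    case False
    then show ?thesis using iterate_word_prefix[OF assms(1), of "Suc i" k] u i
      by (auto simp: nth_append)
  qed
qed

definition prefix_u :: "nat \<Rightarrow> nat \<Rightarrow> letter list" where
  "prefix_u p n = map (u p) [0..<n]"

lemma length_prefix_u [simp]: "length (prefix_u p n) = n"
  by (simp add: prefix_u_def)

lemma prefix_u_0 [simp]: "prefix_u p 0 = []"
  by (simp add: prefix_u_def)

lemma prefix_u_Suc: "prefix_u p (Suc n) = prefix_u p n @ [u p n]"
  by (simp add: prefix_u_def)

lemma prefix_u_eq_take:
  assumes "p > 1" "n \<le> length (iterate_word p k)"
  shows "prefix_u p n = take n (iterate_word p k)"
  using assms by (intro nth_equalityI) (auto simp: prefix_u_def u_eq_iterate_word)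

lemma u_0: "p > 1 \<Longrightarrow> u p 0 = L"
  using u_eq_iterate_word[of p 0 0] by (simp add: iterate_word_def)

lemma phi_word_prefix_u:
  assumes "p > 1"
  shows "phi_word p (prefix_u p m) = prefix_u p (length (phi_word p (prefix_u p m)))"
proof -
  have m: "m \<le> length (iterate_word p m)" using length_iterate_word[OF assms, of m] by simp
  have "iterate_word p (Suc m)
      = phi_word p (take m (iterate_word p m)) @ phi_word p (drop m (iterate_word p m))"
    by (metis append_take_drop_id iterate_word_Suc phi_word_append)
  then have eq: "iterate_word p (Suc m)
      = phi_word p (prefix_u p m) @ phi_word p (drop m (iterate_word p m))"
    using prefix_u_eq_take[OF assms m] by simp
  then show ?thesis
    using prefix_u_eq_take[OF assms, of "length (phi_word p (prefix_u p m))" "Suc m"] by simp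
qed

text \<open>The images of the letters cut the fixed point into blocks: \<open>m\<close> counts the
  full blocks before position \<open>n\<close>, and \<open>j\<close> is the offset in the next one.
  The clause \<open>m < n\<close> permits induction on positions.\<close>

lemma prefix_u_desubstitute:
  assumes "p > 1"
  obtains m j where "j < length (phi p (u p m))"
    "prefix_u p n = phi_word p (prefix_u p m) @ take j (phi p (u p m))"
    "u p n = phi p (u p m) ! j" "n > 0 \<Longrightarrow> m < n" "n = 0 \<Longrightarrow> m = 0"
proof -
  define l where "l m = length (phi_word p (prefix_u p m))" for m
  have l_ge: "m \<le> l m" for m
    unfolding l_def using length_phi_word_ge[of "prefix_u p m" p] by simp
  have l_Suc: "l (Suc m) = l m + length (phi p (u p m))" for m
    by (simp add: l_def prefix_u_Suc)
  \<comment> \<open>The fixed point begins with \<open>L\<close>, whose image has more than one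
    letter.\<close>
  have l_gt: "m < l m" if "m > 0" for m
    using that
  proof (induction m)
    case (Suc m)
    have "length (phi p (u p m)) \<ge> 1"
      using phi_nonempty[of p "u p m"] by (cases "phi p (u p m)") auto
    then show ?case using Suc l_Suc[of m] u_0[OF assms] assms
      by (cases "m = 0") (auto simp: l_def)
  qed simp
  define m where "m = (GREATEST m. l m \<le> n)"
  have bdd: "\<forall>m. l m \<le> n \<longrightarrow> m \<le> n" using l_ge order_trans by blast
  have l0: "l 0 \<le> n" by (simp add: l_def)
  have m1: "l m \<le> n" unfolding m_def using GreatestI_nat[of "\<lambda>m. l m \<le> n", OF l0] bdd by blast
  have m2: "n < l (Suc m)"
  proof (rule ccontr)
    assume "\<not> n < l (Suc m)"
    then have "Suc m \<le> (GREATEST m. l m \<le> n)"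
      using bdd by (intro Greatest_le_nat[of "\<lambda>m. l m \<le> n" _ n]) auto
    then show False using m_def by simp
  qed
  define j where "j = n - l m"
  have j: "j < length (phi p (u p m))" "n = l m + j"
    using m1 m2 l_Suc[of m] by (auto simp: j_def)
  have full: "prefix_u p (l (Suc m)) = phi_word p (prefix_u p m) @ phi p (u p m)"
    using phi_word_prefix_u[OF assms, of "Suc m"] by (simp add: l_def prefix_u_Suc)
  have pre: "prefix_u p k = take k (prefix_u p (l (Suc m)))" if "k \<le> l (Suc m)" for k
    using that by (simp add: prefix_u_def take_map)
  have "prefix_u p n = phi_word p (prefix_u p m) @ take j (phi p (u p m))"
    using pre[of n] m2 unfolding full by (simp add: j l_def)
  moreover have "u p n = phi p (u p m) ! j"
  proof -
    have "u p n = prefix_u p (l (Suc m)) ! n" using m2 by (simp add: prefix_u_def)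
    then show ?thesis unfolding full by (simp add: j l_def nth_append)
  qed
  moreover have "m < n" if "n > 0" using that l_gt[of m] m1 by (cases "m = 0") auto
  moreover have "m = 0" if "n = 0" using that l_ge[of m] m1 by simp
  ultimately show thesis using that j(1) by blast
qed

section \<open>Letter counts of prefixes\<close>

definition occ :: "nat \<Rightarrow> letter \<Rightarrow> nat \<Rightarrow> nat" where
  "occ p a n = count_letter (prefix_u p n) a"

lemma occ_0 [simp]: "occ p a 0 = 0"
  by (simp add: occ_def)

lemma occ_sum: "occ p L n + occ p S n + occ p M n = n"
  using length_eq_count_letters[of "prefix_u p n"] by (simp add: occ_def)

text \<open>\<open>desc p a j b\<close>: the letter \<open>b\<close> stands at position \<open>j\<close> of \<open>phi p a\<close>; all
  letters before it are \<open>L\<close>.\<close>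

definition desc :: "nat \<Rightarrow> letter \<Rightarrow> nat \<Rightarrow> letter \<Rightarrow> bool" where
  "desc p a j b \<longleftrightarrow>
     a = L \<and> j < p \<and> b = L \<or> a = L \<and> j = p \<and> b = S \<or> a = S \<and> j = 0 \<and> b = M \<or>
     a = M \<and> j + 1 < p \<and> b = L \<or> a = M \<and> j + 1 = p \<and> b = S"

lemma occ_desubstitute:
  assumes "p > 1"
  obtains m j where "desc p (u p m) j (u p n)"
    "occ p L n = p * occ p L m + (p - 1) * occ p M m + j"
    "occ p S n = occ p L m + occ p M m" "occ p M n = occ p S m"
    "n > 0 \<Longrightarrow> m < n" "n = 0 \<Longrightarrow> m = 0"
proof -
  obtain m j where j: "j < length (phi p (u p m))"
    and pre: "prefix_u p n = phi_word p (prefix_u p m) @ take j (phi p (u p m))"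
    and un: "u p n = phi p (u p m) ! j" and m: "n > 0 \<Longrightarrow> m < n" "n = 0 \<Longrightarrow> m = 0"
    using prefix_u_desubstitute[OF assms] by metis
  \<comment> \<open>Only the last letter of an image can differ from \<open>L\<close>.\<close>
  have "take j (phi p (u p m)) = replicate j L" using j by (cases "u p m") auto
  then have "occ p L n = p * occ p L m + (p - 1) * occ p M m + j"
    "occ p S n = occ p L m + occ p M m" "occ p M n = occ p S m"
    by (simp_all add: occ_def pre count_letter_phi_word)
  moreover have "desc p (u p m) j (u p n)"
    using j un assms by (cases "u p m") (auto simp: desc_def nth_append)
  ultimately show thesis using that m by blast
qed

lemma count_letter_factor:
  assumes "w = map (u p) [k..<k + length w]"
  shows "occ p a (k + length w) = occ p a k + count_letter w a"
proof -
  have "prefix_u p (k + length w) = prefix_u p k @ w"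
    using assms by (metis map_append prefix_u_def upt_add_eq_append zero_le)
  then show ?thesis by (simp add: occ_def)
qed

section \<open>Bounds for linear functionals on prefixes\<close>

text \<open>\<open>weight p c i\<close> is \<open>(-1)^i\<close> times the functional \<open>g\<close> composed with the \<open>i\<close>-th power of the
  incidence matrix.  Desubstitution adds up alternate terms of \<open>c\<close>, and \<open>tail_bound p c i\<close> is the
  closed form of \<open>(p - 1) (c i + c (i+2) + c (i+4) + ...)\<close>.\<close>

definition tail_bound :: "nat \<Rightarrow> (nat \<Rightarrow> real) \<Rightarrow> nat \<Rightarrow> real" where
  "tail_bound p c i = real p * c i + c (Suc i)"

definition weight :: "nat \<Rightarrow> (nat \<Rightarrow> real) \<Rightarrow> nat \<Rightarrow> nat \<Rightarrow> real" where
  "weight p c i n = c i * real (occ p L n) - tail_bound p c i * real (occ p S n)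
     + tail_bound p c (Suc i) * real (occ p M n)"

text \<open>Cayley-Hamilton for the incidence matrix; with the alternating signs absorbed, the
  characteristic polynomial becomes \<open>x^3 + p x^2 - x - 1\<close>.\<close>

definition linrec :: "nat \<Rightarrow> (nat \<Rightarrow> real) \<Rightarrow> bool" where
  "linrec p c \<longleftrightarrow> (\<forall>i. c (i + 3) = c i + c (i + 1) - real p * c (i + 2))"

text \<open>The recurrence gives \<open>tail_bound p c (i + 2) = c i + c (i + 1)\<close>.\<close>

lemma tail_bound_step:
  assumes "linrec p c"
  shows "tail_bound p c i = tail_bound p c (Suc (Suc i)) + (real p - 1) * c i"
  using assms[unfolded linrec_def, rule_format, of i]
  by (simp add: tail_bound_def algebra_simps numeral_3_eq_3)

text \<open>The counts at \<open>n\<close> are the incidence matrix applied to those at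
  \<open>m\<close>, plus \<open>j\<close> letters \<open>L\<close>. The matrix raises the level by
  one, and the factor \<open>(-1)^i\<close> accounts for the minus sign.\<close>

lemma weight_desubstitute:
  assumes "p > 1" "linrec p c"
  obtains m j where "desc p (u p m) j (u p n)"
    "\<And>i. weight p c i n = real j * c i - weight p c (Suc i) m"
    "n > 0 \<Longrightarrow> m < n"
proof -
  obtain m j where d: "desc p (u p m) j (u p n)"
    and o: "occ p L n = p * occ p L m + (p - 1) * occ p M m + j"
    "occ p S n = occ p L m + occ p M m" "occ p M n = occ p S m" and m: "n > 0 \<Longrightarrow> m < n"
    using occ_desubstitute[OF assms(1)] by metis
  have "weight p c i n = real j * c i - weight p c (Suc i) m" for i
  proof -
    have "real (occ p L n) = p * real (occ p L m) + (real p - 1) * real (occ p M m) + real j"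
      using assms(1) by (simp add: o)
    then have "c i * real (occ p L n)
        = c i * (p * real (occ p L m) + (real p - 1) * real (occ p M m) + real j)" by simp
    moreover have "(real p - 1) * c i = tail_bound p c i - tail_bound p c (Suc (Suc i))"
      using tail_bound_step[OF assms(2), of i] by simp
    then have "((real p - 1) * c i) * real (occ p M m)
        = (tail_bound p c i - tail_bound p c (Suc (Suc i))) * real (occ p M m)" by simp
    moreover have "tail_bound p c i * real (occ p L m)
        = (real p * c i + c (Suc i)) * real (occ p L m)" by (simp add: tail_bound_def)
    ultimately show ?thesis
      by (simp add: weight_def o(2,3) algebra_simps)
  qed
  then show thesis using that d m by blast
qed

definition weight_bounded ::
    "nat \<Rightarrow> (nat \<Rightarrow> real) \<Rightarrow> nat \<Rightarrow> (letter \<Rightarrow> real) \<Rightarrow> (letter \<Rightarrow> real) \<Rightarrow> bool" where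
  "weight_bounded p c i up lo \<longleftrightarrow>
     (\<forall>n. weight p c i n \<le> up (u p n) \<and> - weight p c i n \<le> lo (u p n))"

text \<open>The minus sign in \<open>weight_desubstitute\<close> exchanges upper and lower bounds.
  This carries bounds down to low levels where \<open>cone_bounds\<close> does not apply.\<close>

lemma weight_bounded_step:
  assumes "p > 1" "linrec p c" "weight_bounded p c (Suc i) up lo"
    and "\<And>a j b. desc p a j b \<Longrightarrow> lo a + real j * c i \<le> up' b"
    and "\<And>a j b. desc p a j b \<Longrightarrow> up a - real j * c i \<le> lo' b"
  shows "weight_bounded p c i up' lo'"
  unfolding weight_bounded_def
proof
  fix n
  obtain m j where d: "desc p (u p m) j (u p n)"
    and w: "weight p c i n = real j * c i - weight p c (Suc i) m"
    using weight_desubstitute[OF assms(1,2)] by metis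
  show "weight p c i n \<le> up' (u p n) \<and> - weight p c i n \<le> lo' (u p n)"
    using assms(3)[unfolded weight_bounded_def, rule_format, of m] w assms(4,5)[OF d] by linarith
qed

text \<open>The following letter restricts the offset \<open>j\<close>: at most \<open>p - 1\<close>
  before \<open>L\<close>, at most \<open>p\<close> before \<open>S\<close>, 0 before
  \<open>M\<close>. In \<open>cone_lo\<close>, the letter \<open>S\<close> forces \<open>j\<close>
  to be at least \<open>p - 1\<close>.\<close>

fun cone_up :: "nat \<Rightarrow> (nat \<Rightarrow> real) \<Rightarrow> nat \<Rightarrow> letter \<Rightarrow> real" where
  "cone_up p c i L = tail_bound p c i"
| "cone_up p c i S = tail_bound p c i + c i"
| "cone_up p c i M = tail_bound p c (i + 2)"

fun cone_lo :: "nat \<Rightarrow> (nat \<Rightarrow> real) \<Rightarrow> nat \<Rightarrow> letter \<Rightarrow> real" where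
  "cone_lo p c i L = tail_bound p c (i + 1)"
| "cone_lo p c i S = tail_bound p c (i + 1) - (real p - 1) * c i"
| "cone_lo p c i M = tail_bound p c (i + 1) + c (i + 1)"

lemma desc_mult_le:
  assumes "desc p a j b" "(x::real) \<ge> 0" "p > 1"
  shows "(a = L \<and> b = L \<and> 0 \<le> real j * x \<and> real j * x \<le> (real p - 1) * x) \<or>
    (a = L \<and> b = S \<and> real j * x = real p * x) \<or> (a = S \<and> b = M \<and> real j * x = 0) \<or>
    (a = M \<and> b = L \<and> 0 \<le> real j * x \<and> real j * x \<le> (real p - 2) * x) \<or>
    (a = M \<and> b = S \<and> real j * x = (real p - 1) * x)"
proof -
  have "real j \<le> real p - 1" if "j < p" using that by linarith
  moreover have "real j \<le> real p - 2" if "j + 1 < p" using that by linarith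
  moreover have "real j = real p - 1" if "j + 1 = p" using that by linarith
  ultimately show ?thesis
    using assms unfolding desc_def by (auto intro!: mult_right_mono)
qed

text \<open>Induction on the position for all levels at once, since desubstitution shortens the
  prefix but raises the level.\<close>

lemma cone_bounds:
  assumes p: "p > 1" and rec: "linrec p c"
    and pos: "\<And>i. i \<ge> k \<Longrightarrow> c i \<ge> 0" and dec: "\<And>i. i \<ge> k \<Longrightarrow> c (i + 2) \<le> c i"
    and "i \<ge> k"
  shows "weight_bounded p c i (cone_up p c i) (cone_lo p c i)"
proof -
  let ?T = "tail_bound p c"
  have T: "?T i = ?T (i + 2) + (real p - 1) * c i" for i
    using tail_bound_step[OF rec, of i] by simp
  have "weight p c i n \<le> cone_up p c i (u p n) \<and> - weight p c i n \<le> cone_lo p c i (u p n)"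
    if "i \<ge> k" for i n
    using that
  proof (induction n arbitrary: i rule: less_induct)
    case (less n)
    have T0: "?T j \<ge> 0" if "j \<ge> k" for j using pos that p by (simp add: tail_bound_def)
    show ?case
    proof (cases "n = 0")
      case True
      then show ?thesis using T0 u_0[OF p] less.prems by (simp add: weight_def)
    next
      case False
      obtain m j where d: "desc p (u p m) j (u p n)"
        and w: "weight p c i n = real j * c i - weight p c (Suc i) m" and "m < n"
        using weight_desubstitute[OF p rec] False by (metis neq0_conv)
      then have IH: "weight p c (i + 1) m \<le> cone_up p c (i + 1) (u p m)"
        "- weight p c (i + 1) m \<le> cone_lo p c (i + 1) (u p m)"
        using less by auto
      have nn: "c i \<ge> 0" "(real p - 2) * c i \<ge> 0" "c (Suc (Suc i)) \<le> c i" "c (Suc i) \<ge> 0"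
          "c (Suc (Suc i)) \<ge> 0" "(real p - 1) * c (Suc i) \<ge> 0"
        using pos dec[of i] less.prems p by auto
      have ex: "(real p - 1) * c i = (real p - 2) * c i + c i"
          "real p * c i = (real p - 1) * c i + c i"
        by (simp_all add: algebra_simps)
      have T': "?T i = ?T (Suc (Suc i)) + (real p - 1) * c i"
          "?T (Suc i) = ?T (Suc (Suc (Suc i))) + (real p - 1) * c (Suc i)"
        using T[of i] T[of "Suc i"] by simp_all
      consider (from_LL) "u p m = L" "u p n = L" "0 \<le> real j * c i" "real j * c i \<le> (real p - 1) * c i"
        | (from_LS) "u p m = L" "u p n = S" "real j * c i = real p * c i"
        | (from_SM) "u p m = S" "u p n = M" "real j * c i = 0"
        | (from_ML) "u p m = M" "u p n = L" "0 \<le> real j * c i" "real j * c i \<le> (real p - 2) * c i"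
        | (from_MS) "u p m = M" "u p n = S" "real j * c i = (real p - 1) * c i"
        using desc_mult_le[OF d nn(1) p] by fast
      then show ?thesis
      proof cases
        case from_LL
        have "weight p c (Suc i) m \<le> ?T (Suc i)" "- weight p c (Suc i) m \<le> ?T (Suc (Suc i))"
            "cone_up p c i (u p n) = ?T i" "cone_lo p c i (u p n) = ?T (Suc i)"
          using IH from_LL(1,2) by simp_all
        then show ?thesis using w nn ex T' from_LL(3-) by linarith
      next
        case from_LS
        have "weight p c (Suc i) m \<le> ?T (Suc i)" "- weight p c (Suc i) m \<le> ?T (Suc (Suc i))"
            "cone_up p c i (u p n) = ?T i + c i" "cone_lo p c i (u p n) = ?T (Suc i) - (real p - 1) * c i"
          using IH from_LS(1,2) by simp_all
        then show ?thesis using w nn ex T' from_LS(3-) by linarith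
      next
        case from_SM
        have "weight p c (Suc i) m \<le> ?T (Suc i) + c (Suc i)" "- weight p c (Suc i) m \<le> ?T (Suc (Suc i)) - (real p - 1) * c (Suc i)"
            "cone_up p c i (u p n) = ?T (Suc (Suc i))" "cone_lo p c i (u p n) = ?T (Suc i) + c (Suc i)"
          using IH from_SM(1,2) by simp_all
        then show ?thesis using w nn ex T' from_SM(3-) by linarith
      next
        \<comment> \<open>The offset is at most \<open>p - 2\<close>, and the spare
          \<open>c i\<close> pays for the extra \<open>c (i + 2)\<close> in the lower bound for
          \<open>M\<close>; this uses \<open>c (i + 2) <= c i\<close>.\<close>
        case from_ML
        have "weight p c (Suc i) m \<le> ?T (Suc (Suc (Suc i)))" "- weight p c (Suc i) m \<le> ?T (Suc (Suc i)) + c (Suc (Suc i))"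
            "cone_up p c i (u p n) = ?T i" "cone_lo p c i (u p n) = ?T (Suc i)"
          using IH from_ML(1,2) by simp_all
        then show ?thesis using w nn ex T' from_ML(3-) by linarith
      next
        case from_MS
        have "weight p c (Suc i) m \<le> ?T (Suc (Suc (Suc i)))" "- weight p c (Suc i) m \<le> ?T (Suc (Suc i)) + c (Suc (Suc i))"
            "cone_up p c i (u p n) = ?T i + c i" "cone_lo p c i (u p n) = ?T (Suc i) - (real p - 1) * c i"
          using IH from_MS(1,2) by simp_all
        then show ?thesis using w nn ex T' from_MS(3-) by linarith
      qed
    qed
  qed
  then show ?thesis using assms(5) by (simp add: weight_bounded_def)
qed

section \<open>Two-term recurrences without the dominant root\<close>

fun crec :: "real \<Rightarrow> real \<Rightarrow> real \<Rightarrow> nat \<Rightarrow> real" where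
  "crec b x y 0 = x"
| "crec b x y (Suc 0) = y"
| "crec b x y (Suc (Suc i)) = (b - b\<^sup>2) * crec b x y (Suc i) + b * crec b x y i"

text \<open>The polynomial \<open>x^3 + p x^2 - x - 1\<close> factors as
  \<open>(x + 1/b) (x^2 - (b - b^2) x - b)\<close>, and \<open>crec\<close> follows the second
  factor.\<close>

lemma linrec_crec:
  assumes "real p * b = 1 - b\<^sup>2 + b ^ 3" "b \<noteq> 0"
  shows "linrec p (crec b x y)"
  unfolding linrec_def
proof
  fix i
  let ?c = "crec b x y"
  have r2: "?c (i + 2) = (b - b\<^sup>2) * ?c (i + 1) + b * ?c i"
    and r3: "?c (i + 3) = (b - b\<^sup>2) * ?c (i + 2) + b * ?c (i + 1)"
    by (simp_all add: numeral_2_eq_2 numeral_3_eq_3)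
  have "b * (?c (i + 3) - (?c i + ?c (i + 1) - real p * ?c (i + 2)))
      = b * ?c (i + 3) - b * ?c i - b * ?c (i + 1) + (real p * b) * ?c (i + 2)"
    by (simp add: algebra_simps)
  also have "\<dots> = 0"
    unfolding assms(1) r3 r2 by (simp add: algebra_simps power2_eq_square power3_eq_cube)
  finally show "?c (i + 3) = ?c i + ?c (i + 1) - real p * ?c (i + 2)" using assms(2) by simp
qed

text \<open>The coefficients \<open>b - b^2\<close> and \<open>b\<close> are nonnegative, and the
  differences \<open>c i - c (i + 2)\<close> obey the same recurrence, so two consecutive values of
  each suffice.\<close>

lemma crec_cone:
  assumes b: "0 < b" "b < 1" and "i \<ge> k"
    and "crec b x y k \<ge> 0" "crec b x y (k + 1) \<ge> 0"
    and "crec b x y (k + 2) \<le> crec b x y k" "crec b x y (k + 3) \<le> crec b x y (k + 1)"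
  shows "crec b x y i \<ge> 0 \<and> crec b x y (i + 2) \<le> crec b x y i"
proof -
  let ?c = "crec b x y"
  have d: "b - b\<^sup>2 \<ge> 0" using b by (simp add: power2_eq_square mult_le_one)
  have r: "?c (i + 2) = (b - b\<^sup>2) * ?c (i + 1) + b * ?c i" for i
    by (simp add: numeral_2_eq_2)
  have "(?c i \<ge> 0 \<and> ?c (i + 2) \<le> ?c i) \<and> (?c (i + 1) \<ge> 0 \<and> ?c (i + 3) \<le> ?c (i + 1))"
    using assms(3)
  proof (induction i rule: dec_induct)
    case base
    then show ?case using assms by simp
  next
    case (step i)
    have "?c (i + 2) \<ge> 0" using step r[of i] d b by simp
    moreover have "?c (i + 2) - ?c (i + 4)
        = (b - b\<^sup>2) * (?c (i + 1) - ?c (i + 3)) + b * (?c i - ?c (i + 2))"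
    proof -
      have "?c (i + 4) = (b - b\<^sup>2) * ?c (i + 3) + b * ?c (i + 2)"
        using r[of "i + 2"] by (simp add: numeral_eq_Suc)
      then show ?thesis using r[of i] by (simp only: right_diff_distrib)
    qed
    moreover have "(b - b\<^sup>2) * (?c (i + 1) - ?c (i + 3)) \<ge> 0" "b * (?c i - ?c (i + 2)) \<ge> 0"
      using step d b by simp_all
    ultimately have "?c (i + 2) \<ge> 0" "?c (i + 4) \<le> ?c (i + 2)" by linarith+
    then show ?case using step by (simp add: add.commute numeral_eq_Suc)
  qed
  then show ?thesis by blast
qed

lemma crec_cone_bounds:
  assumes "p > 1" "real p * b = 1 - b\<^sup>2 + b ^ 3" "0 < b" "b < 1"
    and "crec b x y k \<ge> 0" "crec b x y (k + 1) \<ge> 0"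
    and "crec b x y (k + 2) \<le> crec b x y k" "crec b x y (k + 3) \<le> crec b x y (k + 1)"
  shows "weight_bounded p (crec b x y) k (cone_up p (crec b x y) k) (cone_lo p (crec b x y) k)"
proof (rule cone_bounds[OF assms(1) linrec_crec[OF assms(2)], of k])
  show "crec b x y i \<ge> 0" "crec b x y (i + 2) \<le> crec b x y i" if "i \<ge> k" for i
    using crec_cone[OF assms(3,4) that assms(5-8)] by auto
qed (use assms in auto)

lemma weight_bounded_four:
  assumes "weight_bounded p c i up lo"
  shows "weight p c i n1 + weight p c i n2 - weight p c i n3 - weight p c i n4
    \<le> up (u p n1) + up (u p n2) + lo (u p n3) + lo (u p n4)"
  using assms[unfolded weight_bounded_def, rule_format, of n1]
    assms[unfolded weight_bounded_def, rule_format, of n2]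
    assms[unfolded weight_bounded_def, rule_format, of n3]
    assms[unfolded weight_bounded_def, rule_format, of n4]
  by linarith

lemma ex_inverse_root:
  assumes "p > 1"
  obtains b :: real where "0 < b" "b \<le> 1 / real p" "real p * b = 1 - b\<^sup>2 + b ^ 3"
proof -
  let ?f = "\<lambda>x::real. x ^ 3 - x\<^sup>2 - real p * x"
  have "(1 / real p) ^ 3 \<le> (1 / real p)\<^sup>2"
    using assms by (intro power_decreasing) auto
  then have "?f (1 / real p) \<le> - 1" using assms by simp
  moreover have "- 1 \<le> ?f 0" by simp
  moreover have "continuous_on {0..1 / real p} ?f" by (intro continuous_intros)
  ultimately obtain b where b: "0 \<le> b" "b \<le> 1 / real p" "?f b = - 1"
    using IVT2'[of ?f "1 / real p" "- 1" 0] by auto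
  moreover have "b \<noteq> 0" using b(3) by auto
  ultimately show thesis using that[of b] by auto
qed

section \<open>Balance for \<open>p \<ge> 3\<close>\<close>

lemma balanced_ge_3:
  assumes p: "p \<ge> 3" and n: "n1 + n2 = n3 + n4"
  shows "occ p M n1 + occ p M n2 \<le> occ p M n3 + occ p M n4 + 2"
proof (rule ccontr)
  assume "\<not> ?thesis"
  then have dM: "real (occ p M n1) + real (occ p M n2) - real (occ p M n3) - real (occ p M n4) \<ge> 3"
    by linarith
  have p1: "p > 1" using p by simp
  obtain b :: real where b: "0 < b" "b \<le> 1 / real p" and pb: "real p * b = 1 - b\<^sup>2 + b ^ 3"
    using ex_inverse_root[OF p1] .
  have b3: "b \<le> 1 / 3" using b(2) p frac_le[of 1 1 3 "real p"] by linarith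
  have bp: "real p * b \<le> 1" using b(2) p by (simp add: field_simps)
  have sq: "0 < b\<^sup>2" "b\<^sup>2 \<le> b / 3" "0 < b ^ 3" "b ^ 3 \<le> b\<^sup>2 / 3" "0 < b ^ 4" "b ^ 4 \<le> b ^ 3 / 3"
    using b b3 by (auto simp: power2_eq_square power3_eq_cube power4_eq_xxxx)
  \<comment> \<open>These start values make \<open>L\<close> and \<open>S\<close> weigh -1 each, so
    that level 0 compares a multiple of the number of letters \<open>M\<close> with the
    length.\<close>
  define c where "c = crec b (- 1) (real p + 1)"
  have c0: "c 0 = - 1" and c1: "c 1 = real p + 1" by (simp_all add: c_def)
  have c2: "c 2 = (b - b\<^sup>2) * (real p + 1) - b"
    and c3: "c 3 = (b - b\<^sup>2) * c 2 + b * c 1" and c4: "c 4 = (b - b\<^sup>2) * c 3 + b * c 2"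
    by (simp_all add: c_def numeral_eq_Suc)
  have c2': "c 2 = real p * b * (1 - b) - b\<^sup>2"
    unfolding c2 by (simp add: algebra_simps power2_eq_square)
  have c2b: "c 2 = 1 - b - 2 * b\<^sup>2 + 2 * b ^ 3 - b ^ 4"
    unfolding c2' pb by (simp add: algebra_simps power2_eq_square power3_eq_cube power4_eq_xxxx)
  have c2_pos: "c 2 \<ge> 0" and c2_le: "c 2 \<le> 1 - b - b\<^sup>2"
    using c2b sq b b3 by linarith+
  have c3': "c 3 = (b - b\<^sup>2) * c 2 + b + 1 - b\<^sup>2 + b ^ 3"
    unfolding c3 c1 using pb by (simp add: algebra_simps)
  have "(b - b\<^sup>2) * c 2 \<le> (b - b\<^sup>2) * (1 - b)"
    using c2_le sq b b3 by (intro mult_left_mono) linarith+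
  then have c3_le: "c 3 \<le> 1 + 2 * b - 3 * b\<^sup>2 + 2 * b ^ 3"
    using c3' by (simp add: algebra_simps power2_eq_square power3_eq_cube)
  have c3_c1: "c 3 \<le> c 1" using c3_le c1 sq b b3 p by linarith
  have c4_c2: "c 4 \<le> c 2"
  proof -
    have "b * c 3 \<le> b * (1 + 2 * b - 3 * b\<^sup>2 + 2 * b ^ 3)"
      using c3_le b by (intro mult_left_mono) linarith+
    also have "\<dots> = b + 2 * b\<^sup>2 - 3 * b ^ 3 + 2 * b ^ 4"
      by (simp add: algebra_simps power2_eq_square power3_eq_cube power4_eq_xxxx)
    also have "\<dots> \<le> c 2"
    proof -
      \<comment> \<open>The tangent to \<open>b^3\<close> at \<open>1/3\<close>, the end of the
        range where the slack is smallest.\<close>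
      have "(b - 1 / 3)\<^sup>2 * (b + 2 / 3) \<ge> 0" using b by simp
      then have "b ^ 3 \<ge> b / 3 - 2 / 27"
        by (simp add: power2_eq_square power3_eq_cube algebra_simps)
      then show ?thesis using c2b sq b b3 by linarith
    qed
    \<comment> \<open>By the recurrence, \<open>c 4 <= c 2\<close> amounts to
      \<open>(b - b^2) c 3 <= (1 - b) c 2\<close>.\<close>
    finally have "(1 - b) * (b * c 3) \<le> (1 - b) * c 2"
      using b b3 by (intro mult_left_mono) linarith+
    then show ?thesis by (simp add: c4 algebra_simps power2_eq_square)
  qed
  have cone: "weight_bounded p c 1 (cone_up p c 1) (cone_lo p c 1)"
    unfolding c_def
    by (rule crec_cone_bounds[OF p1 pb b(1)])
      (use b3 c1 c2_pos c3_c1 c4_c2 in \<open>simp_all add: c_def numeral_eq_Suc\<close>)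
  let ?T = "tail_bound p c"
  have rec: "linrec p c" unfolding c_def using linrec_crec[OF pb] b by simp
  have T: "?T 0 = 1" "?T 1 = real p * (real p + 1) + c 2" "?T 2 = real p * c 2 + c 3"
    by (simp_all add: tail_bound_def c0 c1[simplified] numeral_eq_Suc)
  have T1_pos: "?T 1 \<ge> 0" unfolding T(2) using c2_pos by simp
  have T31: "?T 3 \<le> ?T 1"
    using tail_bound_step[OF rec, of 1] p c1 by (simp add: numeral_eq_Suc)
  \<comment> \<open>As \<open>c 0\<close> is negative, the cone starts at level 1 and one explicit
    step leads to level 0. Bounds uniform in the letter are enough here.\<close>
  have step: "weight_bounded p c 0 (\<lambda>_. ?T 2 + c 2) (\<lambda>_. ?T 1 + real p + 1)"
  proof (rule weight_bounded_step[OF p1 rec])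
    show "weight_bounded p c (Suc 0) (cone_up p c 1) (cone_lo p c 1)" using cone by simp
  next
    fix a a' j assume d: "desc p a j a'"
    have "(real p - 1) * (real p + 1) \<ge> 0" using p by simp
    then have "cone_lo p c 1 a \<le> ?T 2 + c 2"
      using c2_pos c1 by (cases a) (simp_all add: numeral_2_eq_2)
    then show "cone_lo p c 1 a + real j * c 0 \<le> ?T 2 + c 2" by (simp add: c0)
    have "cone_up p c 1 a + real j \<le> ?T 1 + real p + 1"
      using d c1 T31 by (cases a) (auto simp: desc_def numeral_3_eq_3)
    then show "cone_up p c 1 a - real j * c 0 \<le> ?T 1 + real p + 1" by (simp add: c0)
  qed
  have w: "weight p c 0 n = (?T 1 + 1) * real (occ p M n) - real n" for n
  proof -
    have "real n = real (occ p L n) + real (occ p S n) + real (occ p M n)"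
      using occ_sum[of p n] by linarith
    then show ?thesis by (simp add: weight_def T(1) c0 algebra_simps)
  qed
  have "real n1 + real n2 = real n3 + real n4" using n by linarith
  then have eq: "weight p c 0 n1 + weight p c 0 n2 - weight p c 0 n3 - weight p c 0 n4
      = (?T 1 + 1) * (real (occ p M n1) + real (occ p M n2) - real (occ p M n3) - real (occ p M n4))"
    by (simp add: w algebra_simps)
  have "(?T 1 + 1) * 3 \<le> weight p c 0 n1 + weight p c 0 n2 - weight p c 0 n3 - weight p c 0 n4"
    unfolding eq using dM T1_pos by (intro mult_left_mono) simp_all
  also note weight_bounded_four[OF step, of n1 n2 n3 n4]
  finally have "(?T 1 + 1) * 3 \<le> 2 * (?T 2 + c 2) + 2 * (?T 1 + real p + 1)" by simp
  then have le: "(real p)\<^sup>2 + real p + 1 \<le> 2 * (real p * c 2) + 2 * c 3 + c 2 + 2 * real p"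
    unfolding T(2,3) by (simp add: algebra_simps power2_eq_square)
  show False
  proof (cases "p = 3")
    case True
    have "c 2 = 3 * b - 4 * b\<^sup>2" by (simp add: c2 True algebra_simps)
    \<comment> \<open>The maximum of \<open>3 b - 4 b^2\<close> lies at
      \<open>b = 3/8\<close>.\<close>
    moreover have "(b - 3 / 8)\<^sup>2 \<ge> 0" by simp
    then have "3 * b - 4 * b\<^sup>2 \<le> 9 / 16" by (simp add: power2_eq_square algebra_simps)
    ultimately have c29: "c 2 \<le> 9 / 16" by simp
    have "(b - 1 / 3) * (b - 2 / 3) \<ge> 0" using b3 by (intro mult_nonpos_nonpos) auto
    moreover have "(b - 1 / 3) * (b - 2 / 3) = b\<^sup>2 - b + 2 / 9"
      by (simp add: power2_eq_square field_simps)
    ultimately have "b - b\<^sup>2 \<le> 2 / 9" by linarith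
    then have "(b - b\<^sup>2) * c 2 \<le> 2 / 9 * (9 / 16)"
      using c29 c2_pos by (intro mult_mono) auto
    then have "c 3 \<le> 1 / 8 + 4 / 3" using c3 c1 b3 True by simp
    then show False using le c29 True by simp
  next
    case False
    then have p4: "real p \<ge> 4" using p by linarith
    have "c 2 \<le> 1" using c2_le b(1) sq(1) by linarith
    then have "real p * c 2 \<le> real p * 1" by (intro mult_left_mono) auto
    moreover have "(real p - 4) * (real p + 1) \<ge> 0" using p4 by simp
    then have "(real p)\<^sup>2 \<ge> 3 * real p + 4" by (simp add: power2_eq_square algebra_simps)
    ultimately show False using le c3_le c2_le sq b b3 by linarith
  qed
qed

section \<open>Balance for \<open>p = 2\<close>\<close>

lemma desc_2:
  "desc 2 a j b \<longleftrightarrow> (a, j, b) \<in> {(L, 0, L), (L, 1, L), (L, 2, S), (S, 0, M), (M, 0, L), (M, 1, S)}"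
  unfolding desc_def by auto

lemma root_2:
  obtains b :: real where "0.44504 \<le> b" "b \<le> 0.44505" "real 2 * b = 1 - b\<^sup>2 + b ^ 3"
proof -
  let ?f = "\<lambda>x::real. x ^ 3 - x\<^sup>2 - 2 * x"
  have "?f 0.44505 \<le> - 1" "- 1 \<le> ?f 0.44504" by (simp_all add: power2_eq_square power3_eq_cube)
  moreover have "continuous_on {0.44504..0.44505} ?f" by (intro continuous_intros)
  ultimately obtain b where "0.44504 \<le> b" "b \<le> 0.44505" "?f b = - 1"
    using IVT2'[of ?f "0.44505" "- 1" "0.44504"] by auto
  then show thesis using that[of b] by auto
qed

text \<open>The discrepancy of \<open>M\<close>, with \<open>z = c 2\<close>. As
  \<open>linrec\<close> has integer coefficients, all bounds have the form
  \<open>k + l z\<close>.\<close>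

lemma weight_bounds_2_frequency:
  obtains z :: real where "0.2958 \<le> z" "z \<le> 0.296"
    "\<And>n. (7 + z) * real (occ 2 M n) - real n \<le> case_letter (1 + 5 * z) (5 * z) (z - 3) (u 2 n)"
    "\<And>n. real n - (7 + z) * real (occ 2 M n) \<le> case_letter (7 + z) (8 + z) (9 + z) (u 2 n)"
proof -
  obtain b :: real where b: "0.44504 \<le> b" "b \<le> 0.44505" and pb: "real 2 * b = 1 - b\<^sup>2 + b ^ 3"
    using root_2 .
  define z where "z = 2 * b - 3 * b\<^sup>2"
  have "0.44504\<^sup>2 \<le> b\<^sup>2" "b\<^sup>2 \<le> 0.44505\<^sup>2" using b by (auto intro!: power_mono)
  then have "0.198060 \<le> b\<^sup>2" "b\<^sup>2 \<le> 0.19807" by (simp_all add: power2_eq_square)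
  then have z: "0.2958 \<le> z" "z \<le> 0.296" using b by (simp_all add: z_def)
  have two: "(2::nat) > 1" by simp
  define c where "c = crec b (- 1) 3"
  have rec: "linrec 2 c" unfolding c_def using linrec_crec[OF pb] b by simp
  have r: "c (Suc (Suc (Suc i))) = c i + c (Suc i) - 2 * c (Suc (Suc i))" for i
    using rec by (simp add: linrec_def numeral_eq_Suc)
  have c: "c 0 = - 1" "c (Suc 0) = 3" "c (Suc (Suc 0)) = z"
    by (simp_all add: c_def z_def algebra_simps)
  have c': "c (Suc (Suc (Suc 0))) = 2 - 2 * z" "c (Suc (Suc (Suc (Suc 0)))) = 5 * z - 1"
      "c (Suc (Suc (Suc (Suc (Suc 0))))) = 4 - 11 * z"
      "c (Suc (Suc (Suc (Suc (Suc (Suc 0)))))) = 25 * z - 7"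
    by (simp_all add: r c)
  note cs = c c'
  \<comment> \<open>Since \<open>c 0 < 0\<close> and \<open>c 4 > c 2\<close>, the cone conditions
    fail before level 3; the lower levels are computed letter by letter.\<close>
  have "weight_bounded 2 c 3 (cone_up 2 c 3) (cone_lo 2 c 3)"
    unfolding c_def by (rule crec_cone_bounds[OF _ pb])
      (use b z cs in \<open>simp_all add: c_def numeral_eq_Suc\<close>)
  moreover have "cone_up 2 c 3 = case_letter (3 + z) (5 - z) (1 + 3 * z)"
    and "cone_lo 2 c 3 = case_letter (2 - z) z (1 + 4 * z)"
    by (rule ext, case_tac x; simp add: tail_bound_def numeral_eq_Suc cs)+
  ultimately have "weight_bounded 2 c (Suc 2)
      (case_letter (3 + z) (5 - z) (1 + 3 * z)) (case_letter (2 - z) z (1 + 4 * z))"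
    by simp
  then have "weight_bounded 2 c 2
      (case_letter (1 + 4 * z) (1 + 5 * z) z) (case_letter (3 + z) (3 - z) (5 - z))"
    by (rule weight_bounded_step[OF two rec])
      (use z c(3) in \<open>auto simp: desc_2 numeral_2_eq_2[symmetric]\<close>)
  then have "weight_bounded 2 c (Suc 1)
      (case_letter (1 + 4 * z) (1 + 5 * z) z) (case_letter (3 + z) (3 - z) (5 - z))"
    by (simp add: numeral_2_eq_2)
  then have "weight_bounded 2 c 1
      (case_letter (6 + z) (9 + z) (3 - z)) (case_letter (1 + 4 * z) (z - 3) (1 + 5 * z))"
    by (rule weight_bounded_step[OF two rec]) (use z in \<open>auto simp: desc_2 cs\<close>)
  then have "weight_bounded 2 c (Suc 0)
      (case_letter (6 + z) (9 + z) (3 - z)) (case_letter (1 + 4 * z) (z - 3) (1 + 5 * z))"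
    by simp
  then have wb: "weight_bounded 2 c 0
      (case_letter (1 + 5 * z) (5 * z) (z - 3)) (case_letter (7 + z) (8 + z) (9 + z))"
    by (rule weight_bounded_step[OF two rec]) (use z in \<open>auto simp: desc_2 cs\<close>)
  have w: "weight 2 c 0 n = (7 + z) * real (occ 2 M n) - real n" for n
  proof -
    have "real n = real (occ 2 L n) + real (occ 2 S n) + real (occ 2 M n)"
      using occ_sum[of 2 n] by linarith
    then show ?thesis by (simp add: weight_def tail_bound_def cs algebra_simps)
  qed
  show thesis
  proof (rule that[OF z])
    fix n
    show "(7 + z) * real (occ 2 M n) - real n \<le> case_letter (1 + 5 * z) (5 * z) (z - 3) (u 2 n)"
      "real n - (7 + z) * real (occ 2 M n) \<le> case_letter (7 + z) (8 + z) (9 + z) (u 2 n)"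
      using wb[unfolded weight_bounded_def w, rule_format, of n] by simp_all
  qed
qed

text \<open>A second functional vanishing on the letter frequencies, not proportional to the first,
  which confines count differences in another direction.\<close>

lemma weight_bounds_2_auxiliary:
  obtains b :: real where "0.4450 \<le> b" "b \<le> 0.4451"
    "\<And>n. real (occ 2 L n) - 2 * real (occ 2 S n) + b * real (occ 2 M n)
       \<le> case_letter 2 3 1 (u 2 n)"
    "\<And>n. 2 * real (occ 2 S n) - real (occ 2 L n) - b * real (occ 2 M n)
       \<le> case_letter (1 - b) (- 1) (1 - b) (u 2 n)"
proof -
  obtain b :: real where b: "0.44504 \<le> b" "b \<le> 0.44505" and pb: "real 2 * b = 1 - b\<^sup>2 + b ^ 3"
    using root_2 .
  have two: "(2::nat) > 1" by simp
  define c where "c = crec b 1 0"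
  have rec: "linrec 2 c" unfolding c_def using linrec_crec[OF pb] b by simp
  have r: "c (Suc (Suc (Suc i))) = c i + c (Suc i) - 2 * c (Suc (Suc i))" for i
    using rec by (simp add: linrec_def numeral_eq_Suc)
  have c: "c 0 = 1" "c (Suc 0) = 0" "c (Suc (Suc 0)) = b"
    by (simp_all add: c_def)
  have c': "c (Suc (Suc (Suc 0))) = 1 - 2 * b" "c (Suc (Suc (Suc (Suc 0)))) = 5 * b - 2"
      "c (Suc (Suc (Suc (Suc (Suc 0))))) = 5 - 11 * b"
    by (simp_all add: r c)
  note cs = c c'
  \<comment> \<open>Since \<open>c 1 = 0 < c 3\<close>, the cone conditions fail at levels 0 and
    1.\<close>
  have "weight_bounded 2 c 2 (cone_up 2 c 2) (cone_lo 2 c 2)"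
    unfolding c_def by (rule crec_cone_bounds[OF _ pb])
      (use b cs in \<open>simp_all add: c_def numeral_eq_Suc\<close>)
  moreover have "cone_up 2 c 2 = case_letter 1 (1 + b) (1 - b)"
    and "cone_lo 2 c 2 = case_letter b 0 (1 - b)"
    by (rule ext, case_tac x; simp add: tail_bound_def numeral_eq_Suc cs)+
  ultimately have "weight_bounded 2 c (Suc 1) (case_letter 1 (1 + b) (1 - b)) (case_letter b 0 (1 - b))"
    by (simp add: numeral_2_eq_2)
  then have "weight_bounded 2 c 1
      (case_letter (1 - b) (1 - b) 0) (case_letter 1 1 (1 + b))"
    by (rule weight_bounded_step[OF two rec])
      (use b in \<open>auto simp: desc_2 cs\<close>)
  then have "weight_bounded 2 c (Suc 0)
      (case_letter (1 - b) (1 - b) 0) (case_letter 1 1 (1 + b))" by simp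
  then have wb: "weight_bounded 2 c 0 (case_letter 2 3 1) (case_letter (1 - b) (- 1) (1 - b))"
    by (rule weight_bounded_step[OF two rec]) (use b in \<open>auto simp: desc_2 cs\<close>)
  have w: "weight 2 c 0 n = real (occ 2 L n) - 2 * real (occ 2 S n) + b * real (occ 2 M n)" for n
    by (simp add: weight_def tail_bound_def cs)
  show thesis
  proof (rule that[of b])
    fix n
    show "real (occ 2 L n) - 2 * real (occ 2 S n) + b * real (occ 2 M n) \<le> case_letter 2 3 1 (u 2 n)"
      "2 * real (occ 2 S n) - real (occ 2 L n) - b * real (occ 2 M n)
       \<le> case_letter (1 - b) (- 1) (1 - b) (u 2 n)"
      using wb[unfolded weight_bounded_def w, rule_format, of n] by simp_all
  qed (use b in auto)
qed

text \<open>A pair \<open>(k, l)\<close> encodes \<open>k + l z\<close>, where \<open>z\<close> is the irrational number from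
  \<open>weight_bounds_2_frequency\<close> (for \<open>freq_up\<close>, \<open>freq_lo\<close>) or \<open>b\<close> from
  \<open>weight_bounds_2_auxiliary\<close> (for \<open>aux_up\<close>, \<open>aux_lo\<close>).\<close>

fun freq_up :: "letter \<Rightarrow> int \<times> int" where
  "freq_up L = (1, 5)" | "freq_up S = (0, 5)" | "freq_up M = (- 3, 1)"

fun freq_lo :: "letter \<Rightarrow> int \<times> int" where
  "freq_lo L = (7, 1)" | "freq_lo S = (8, 1)" | "freq_lo M = (9, 1)"

fun aux_up :: "letter \<Rightarrow> int \<times> int" where
  "aux_up L = (2, 0)" | "aux_up S = (3, 0)" | "aux_up M = (1, 0)"

fun aux_lo :: "letter \<Rightarrow> int \<times> int" where
  "aux_lo L = (1, - 1)" | "aux_lo S = (- 1, 0)" | "aux_lo M = (1, - 1)"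

text \<open>A configuration consists of the difference of letter counts (in the order \<open>L\<close>, \<open>S\<close>, \<open>M\<close>)
  between two pairs of prefixes, and of the letters following these prefixes.\<close>

type_synonym config = "(int \<times> int \<times> int) \<times> (letter \<times> letter) \<times> (letter \<times> letter)"

text \<open>A necessary condition for \<open>v \<le> a + b + c + d\<close> when all that is known about the irrational
  number is that it lies between \<open>l / 10000\<close> and \<open>h / 10000\<close>.\<close>

definition may_le :: "int \<Rightarrow> int \<Rightarrow> int \<times> int \<Rightarrow> int \<times> int \<Rightarrow> int \<times> int \<Rightarrow> int \<times> int \<Rightarrow>
    int \<times> int \<Rightarrow> bool" where
  "may_le l h v a b c d \<longleftrightarrow>
     (let k = snd v - (snd a + snd b + snd c + snd d) in
       10000 * (fst v - (fst a + fst b + fst c + fst d)) + min (l * k) (h * k) \<le> 0)"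

text \<open>Upper and lower bounds for \<open>(7 + z) w - (x + y + w)\<close> and for
  \<open>x - 2 y + b w\<close>.\<close>

fun feasible :: "config \<Rightarrow> bool" where
  "feasible ((x, y, w), (a, b), (c, d)) \<longleftrightarrow>
     may_le 2958 2960 (6 * w - x - y, w) (freq_up a) (freq_up b) (freq_lo c) (freq_lo d) \<and>
     may_le 2958 2960 (x + y - 6 * w, - w) (freq_lo a) (freq_lo b) (freq_up c) (freq_up d) \<and>
     may_le 4450 4451 (x - 2 * y, w) (aux_up a) (aux_up b) (aux_lo c) (aux_lo d) \<and>
     may_le 4450 4451 (2 * y - x, - w) (aux_lo a) (aux_lo b) (aux_up c) (aux_up d)"

fun parents :: "letter \<Rightarrow> (letter \<times> int) list" where
  "parents L = [(L, 0), (L, 1), (M, 0)]"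
| "parents S = [(L, 2), (M, 1)]"
| "parents M = [(S, 0)]"

text \<open>The inverse incidence matrix: \<open>x = 2 x' + w' + e\<close>,
  \<open>y = x' + w'\<close>, \<open>w = y'\<close> are solved for the primed counts, where
  \<open>e = i + j - k - l\<close>.\<close>

fun parent_config :: "config \<Rightarrow> letter \<times> int \<Rightarrow> letter \<times> int \<Rightarrow> letter \<times> int \<Rightarrow> letter \<times> int \<Rightarrow> config" where
  "parent_config ((x, y, w), _) (a, i) (b, j) (c, k) (d, l) =
     ((x - (i + j - k - l) - y, w, 2 * y - x + (i + j - k - l)), (a, b), (c, d))"

fun parent_configs :: "config \<Rightarrow> config list" where
  "parent_configs (v, (a, b), (c, d)) =
     [parent_config (v, (a, b), (c, d)) a' b' c' d'.
       a' \<leftarrow> parents a, b' \<leftarrow> parents b, c' \<leftarrow> parents c, d' \<leftarrow> parents d]"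

text \<open>Exchanging the prefixes within a pair changes no count, so representatives
  suffice.\<close>

fun swaps :: "config \<Rightarrow> config list" where
  "swaps (v, (a, b), (c, d)) =
     [(v, (a, b), (c, d)), (v, (b, a), (c, d)), (v, (a, b), (d, c)), (v, (b, a), (d, c))]"

text \<open>Found by a backward search from the configurations with total length difference 0 and
  \<open>M\<close>-difference 3, discarding infeasible ancestors.\<close>

definition bad_configs :: "config list" where
  "bad_configs = concat (map swaps
    [((- 4, 1, 3), (L, L), (M, S)), ((- 3, 0, 3), (L, L), (M, M)),
     ((- 3, 0, 3), (L, L), (M, S)), ((- 2, - 1, 3), (L, L), (M, M)),
     ((- 2, - 1, 3), (L, L), (M, S)), ((- 2, - 1, 3), (L, S), (M, M)),
     ((- 1, - 2, 3), (L, L), (M, M)), ((- 1, - 2, 3), (L, S), (M, M)),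
     ((- 1, 3, 0), (L, L), (S, S)), ((- 1, 3, 0), (L, M), (S, S)),
     ((- 1, 3, 0), (M, M), (S, S)), ((0, 3, - 2), (L, L), (S, S)),
     ((0, 3, - 2), (L, M), (S, S)), ((0, 3, - 2), (M, M), (S, S)),
     ((1, 3, - 2), (L, L), (L, S)), ((1, 3, - 2), (L, M), (L, S)),
     ((1, 3, - 2), (M, M), (L, S)), ((0, 0, 3), (L, L), (L, L)),
     ((1, - 2, 2), (L, S), (L, L)), ((1, - 2, 2), (S, S), (L, L)),
     ((0, 2, - 2), (L, L), (L, L)), ((0, 2, - 2), (L, M), (L, L)),
     ((1, 2, - 3), (M, M), (L, L)), ((2, 3, - 2), (L, L), (L, L)),
     ((2, 3, - 2), (L, M), (L, L)), ((2, 3, - 2), (M, M), (L, L)),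
     ((0, - 3, 2), (S, S), (L, L)), ((0, - 3, 2), (S, S), (L, M)),
     ((0, - 2, 2), (L, L), (L, L)), ((0, - 2, 2), (L, S), (L, L)),
     ((- 1, 2, - 2), (L, L), (L, S))])"

definition closed_under_parents :: "config list \<Rightarrow> bool" where
  "closed_under_parents xs \<longleftrightarrow>
     list_all (\<lambda>x. list_all (\<lambda>y. if feasible y then List.member xs y else True) (parent_configs x)) xs"

lemma bad_closed: "closed_under_parents bad_configs"
  by code_simp

text \<open>Equal total length fixes the \<open>L\<close>-difference as \<open>- y - 3\<close>; the
  range of \<open>y\<close> is justified in \<open>balanced_2\<close>.\<close>

lemma bad_initial:
  "list_all (\<lambda>y. list_all (\<lambda>a. list_all (\<lambda>b. list_all (\<lambda>c. list_all (\<lambda>d.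
     let x = ((- y - 3, y, 3), (a, b), (c, d)) in
     if feasible x then List.member bad_configs x else True)
     [L, S, M]) [L, S, M]) [L, S, M]) [L, S, M]) [- 3, - 2, - 1, 0, 1]"
  by code_simp

text \<open>The sign of the coefficient of \<open>t\<close> decides which endpoint gives the
  minimum.\<close>

lemma may_leI:
  fixes t :: real
  assumes "real_of_int l \<le> 10000 * t" "10000 * t \<le> real_of_int h"
    and "of_int (fst v) + of_int (snd v) * t \<le> (of_int (fst a) + of_int (snd a) * t)
      + (of_int (fst b) + of_int (snd b) * t) + (of_int (fst c) + of_int (snd c) * t)
      + (of_int (fst d) + of_int (snd d) * t)"
  shows "may_le l h v a b c d"
proof -
  define k where "k = snd v - (snd a + snd b + snd c + snd d)"
  define e where "e = fst v - (fst a + fst b + fst c + fst d)"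
  have "10000 * of_int e + of_int k * (10000 * t) \<le> (0::real)"
    using assms(3) by (simp add: k_def e_def algebra_simps)
  moreover have "of_int (min (l * k) (h * k)) \<le> of_int k * (10000 * t)"
  proof (cases "k \<ge> 0")
    case True
    then have "of_int k * real_of_int l \<le> of_int k * (10000 * t)"
      using assms(1) by (intro mult_left_mono) auto
    moreover have "real_of_int (min (l * k) (h * k)) \<le> of_int (l * k)" by linarith
    ultimately show ?thesis by (simp add: mult.commute)
  next
    case False
    then have "of_int k * real_of_int h \<le> of_int k * (10000 * t)"
      using assms(2) by (intro mult_left_mono_neg) auto
    moreover have "real_of_int (min (l * k) (h * k)) \<le> of_int (h * k)" by linarith
    ultimately show ?thesis by (simp add: mult.commute)
  qed
  ultimately have "real_of_int (10000 * e + min (l * k) (h * k)) \<le> 0" by simp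
  then show ?thesis unfolding may_le_def Let_def k_def e_def by linarith
qed

section \<open>Configurations of actual prefixes and descent\<close>

definition occ_diff :: "letter \<Rightarrow> nat \<Rightarrow> nat \<Rightarrow> nat \<Rightarrow> nat \<Rightarrow> int" where
  "occ_diff a n1 n2 n3 n4 =
     int (occ 2 a n1) + int (occ 2 a n2) - int (occ 2 a n3) - int (occ 2 a n4)"

definition config_of :: "nat \<Rightarrow> nat \<Rightarrow> nat \<Rightarrow> nat \<Rightarrow> config" where
  "config_of n1 n2 n3 n4 =
     ((occ_diff L n1 n2 n3 n4, occ_diff S n1 n2 n3 n4, occ_diff M n1 n2 n3 n4),
      (u 2 n1, u 2 n2), (u 2 n3, u 2 n4))"

lemma freq_pair:
  "of_int (fst (freq_up a)) + of_int (snd (freq_up a)) * z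
    = (case_letter (1 + 5 * z) (5 * z) (z - 3) a :: real)"
  "of_int (fst (freq_lo a)) + of_int (snd (freq_lo a)) * z
    = (case_letter (7 + z) (8 + z) (9 + z) a :: real)"
  by (cases a; simp)+

lemma aux_pair:
  "of_int (fst (aux_up a)) + of_int (snd (aux_up a)) * z = (case_letter 2 3 1 a :: real)"
  "of_int (fst (aux_lo a)) + of_int (snd (aux_lo a)) * z
    = (case_letter (1 - z) (- 1) (1 - z) a :: real)"
  by (cases a; simp)+

lemma feasible_config_of: "feasible (config_of n1 n2 n3 n4)"
proof -
  let ?x = "occ_diff L n1 n2 n3 n4" and ?y = "occ_diff S n1 n2 n3 n4"
    and ?w = "occ_diff M n1 n2 n3 n4"
  obtain z :: real where z: "0.2958 \<le> z" "z \<le> 0.296"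
    and up: "\<And>n. (7 + z) * real (occ 2 M n) - real n \<le> case_letter (1 + 5 * z) (5 * z) (z - 3) (u 2 n)"
    and lo: "\<And>n. real n - (7 + z) * real (occ 2 M n) \<le> case_letter (7 + z) (8 + z) (9 + z) (u 2 n)"
    using weight_bounds_2_frequency by blast
  obtain b :: real where b: "0.4450 \<le> b" "b \<le> 0.4451"
    and bup: "\<And>n. real (occ 2 L n) - 2 * real (occ 2 S n) + b * real (occ 2 M n)
       \<le> case_letter 2 3 1 (u 2 n)"
    and blo: "\<And>n. 2 * real (occ 2 S n) - real (occ 2 L n) - b * real (occ 2 M n)
       \<le> case_letter (1 - b) (- 1) (1 - b) (u 2 n)"
    using weight_bounds_2_auxiliary by blast
  have len: "real n = real (occ 2 L n) + real (occ 2 S n) + real (occ 2 M n)" for n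
    using occ_sum[of 2 n] by linarith
  let ?f = "\<lambda>n. (7 + z) * real (occ 2 M n) - real n"
  let ?g = "\<lambda>n. real (occ 2 L n) - 2 * real (occ 2 S n) + b * real (occ 2 M n)"
  have f: "of_int (6 * ?w - ?x - ?y) + of_int ?w * z = ?f n1 + ?f n2 - ?f n3 - ?f n4"
    by (simp add: occ_diff_def len[of n1] len[of n2] len[of n3] len[of n4] algebra_simps)
  have g: "of_int (?x - 2 * ?y) + of_int ?w * b = ?g n1 + ?g n2 - ?g n3 - ?g n4"
    by (simp add: occ_diff_def algebra_simps)
  have neg: "of_int (?x + ?y - 6 * ?w) + of_int (- ?w) * z = - (of_int (6 * ?w - ?x - ?y) + of_int ?w * z)"
    "of_int (2 * ?y - ?x) + of_int (- ?w) * b = - (of_int (?x - 2 * ?y) + of_int ?w * b)"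
    by simp_all
  show ?thesis
    unfolding config_of_def feasible.simps
  proof (intro conjI)
    show "may_le 2958 2960 (6 * ?w - ?x - ?y, ?w)
        (freq_up (u 2 n1)) (freq_up (u 2 n2)) (freq_lo (u 2 n3)) (freq_lo (u 2 n4))"
      using z up[of n1] up[of n2] lo[of n3] lo[of n4]
      by (intro may_leI[where t = z]) (simp_all only: freq_pair fst_conv snd_conv f, simp_all)
    show "may_le 2958 2960 (?x + ?y - 6 * ?w, - ?w)
        (freq_lo (u 2 n1)) (freq_lo (u 2 n2)) (freq_up (u 2 n3)) (freq_up (u 2 n4))"
      using z lo[of n1] lo[of n2] up[of n3] up[of n4]
      by (intro may_leI[where t = z]) (simp_all only: freq_pair fst_conv snd_conv neg f, simp_all)
    show "may_le 4450 4451 (?x - 2 * ?y, ?w)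
        (aux_up (u 2 n1)) (aux_up (u 2 n2)) (aux_lo (u 2 n3)) (aux_lo (u 2 n4))"
      using b bup[of n1] bup[of n2] blo[of n3] blo[of n4]
      by (intro may_leI[where t = b]) (simp_all only: aux_pair fst_conv snd_conv g, simp_all)
    show "may_le 4450 4451 (2 * ?y - ?x, - ?w)
        (aux_lo (u 2 n1)) (aux_lo (u 2 n2)) (aux_up (u 2 n3)) (aux_up (u 2 n4))"
      using b blo[of n1] blo[of n2] bup[of n3] bup[of n4]
      by (intro may_leI[where t = b]) (simp_all only: aux_pair fst_conv snd_conv neg g, simp_all)
  qed
qed

lemma desc_2_parents: "desc 2 a j b \<Longrightarrow> (a, int j) \<in> set (parents b)"
  by (auto simp: desc_2)

lemma occ_2_desubstitute:
  obtains m j where "(u 2 m, j) \<in> set (parents (u 2 n))"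
    "int (occ 2 L n) = 2 * int (occ 2 L m) + int (occ 2 M m) + j"
    "int (occ 2 S n) = int (occ 2 L m) + int (occ 2 M m)" "int (occ 2 M n) = int (occ 2 S m)"
    "m \<le> n" "n > 0 \<Longrightarrow> m < n"
proof -
  obtain m j where d: "desc 2 (u 2 m) j (u 2 n)"
    and o: "occ 2 L n = 2 * occ 2 L m + (2 - 1) * occ 2 M m + j"
    "occ 2 S n = occ 2 L m + occ 2 M m" "occ 2 M n = occ 2 S m"
    and m: "n > 0 \<Longrightarrow> m < n" "n = 0 \<Longrightarrow> m = 0"
    using occ_desubstitute[of 2 n] by (metis one_less_numeral_iff semiring_norm(76))
  have "m \<le> n" using m by (cases "n = 0") auto
  with desc_2_parents[OF d] o m(1) show thesis by (intro that[of m "int j"]) auto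
qed

lemma parent_configsI:
  assumes "a' \<in> set (parents a)" "b' \<in> set (parents b)"
    "c' \<in> set (parents c)" "d' \<in> set (parents d)"
  shows "parent_config (v, (a, b), (c, d)) a' b' c' d' \<in> set (parent_configs (v, (a, b), (c, d)))"
proof -
  have "set (parent_configs (v, (a, b), (c, d))) = (\<Union>a'\<in>set (parents a). \<Union>b'\<in>set (parents b).
      \<Union>c'\<in>set (parents c). parent_config (v, (a, b), (c, d)) a' b' c' ` set (parents d))"
    by (simp del: parents.simps parent_config.simps)
  then show ?thesis using assms by blast
qed

lemma config_of_parent:
  obtains m1 m2 m3 m4 where
    "config_of m1 m2 m3 m4 \<in> set (parent_configs (config_of n1 n2 n3 n4))"
    "n1 + n2 + n3 + n4 > 0 \<Longrightarrow> m1 + m2 + m3 + m4 < n1 + n2 + n3 + n4"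
proof -
  obtain m1 j1 where 1: "(u 2 m1, j1) \<in> set (parents (u 2 n1))"
    "int (occ 2 L n1) = 2 * int (occ 2 L m1) + int (occ 2 M m1) + j1"
    "int (occ 2 S n1) = int (occ 2 L m1) + int (occ 2 M m1)" "int (occ 2 M n1) = int (occ 2 S m1)"
    "m1 \<le> n1" "n1 > 0 \<Longrightarrow> m1 < n1"
    using occ_2_desubstitute[of n1] by blast
  obtain m2 j2 where 2: "(u 2 m2, j2) \<in> set (parents (u 2 n2))"
    "int (occ 2 L n2) = 2 * int (occ 2 L m2) + int (occ 2 M m2) + j2"
    "int (occ 2 S n2) = int (occ 2 L m2) + int (occ 2 M m2)" "int (occ 2 M n2) = int (occ 2 S m2)"
    "m2 \<le> n2" "n2 > 0 \<Longrightarrow> m2 < n2"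
    using occ_2_desubstitute[of n2] by blast
  obtain m3 j3 where 3: "(u 2 m3, j3) \<in> set (parents (u 2 n3))"
    "int (occ 2 L n3) = 2 * int (occ 2 L m3) + int (occ 2 M m3) + j3"
    "int (occ 2 S n3) = int (occ 2 L m3) + int (occ 2 M m3)" "int (occ 2 M n3) = int (occ 2 S m3)"
    "m3 \<le> n3" "n3 > 0 \<Longrightarrow> m3 < n3"
    using occ_2_desubstitute[of n3] by blast
  obtain m4 j4 where 4: "(u 2 m4, j4) \<in> set (parents (u 2 n4))"
    "int (occ 2 L n4) = 2 * int (occ 2 L m4) + int (occ 2 M m4) + j4"
    "int (occ 2 S n4) = int (occ 2 L m4) + int (occ 2 M m4)" "int (occ 2 M n4) = int (occ 2 S m4)"
    "m4 \<le> n4" "n4 > 0 \<Longrightarrow> m4 < n4"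
    using occ_2_desubstitute[of n4] by blast
  have eq: "config_of m1 m2 m3 m4
      = parent_config (config_of n1 n2 n3 n4) (u 2 m1, j1) (u 2 m2, j2) (u 2 m3, j3) (u 2 m4, j4)"
    using 1(2-4) 2(2-4) 3(2-4) 4(2-4) by (simp add: config_of_def occ_diff_def)
  show thesis
  proof (rule that[of m1 m2 m3 m4])
    show "config_of m1 m2 m3 m4 \<in> set (parent_configs (config_of n1 n2 n3 n4))"
      unfolding eq unfolding config_of_def by (rule parent_configsI[OF 1(1) 2(1) 3(1) 4(1)])
    show "m1 + m2 + m3 + m4 < n1 + n2 + n3 + n4" if "n1 + n2 + n3 + n4 > 0"
      using that 1(5,6) 2(5,6) 3(5,6) 4(5,6) by linarith
  qed
qed

text \<open>A bad configuration of actual prefixes has an actual parent, which is feasible and hence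
  bad by \<open>bad_closed\<close>. This descent would end at four empty prefixes, whose zero
  difference is not listed.\<close>

lemma config_of_not_bad: "config_of n1 n2 n3 n4 \<notin> set bad_configs"
proof (induction "n1 + n2 + n3 + n4" arbitrary: n1 n2 n3 n4 rule: less_induct)
  case less
  show ?case
  proof
    assume bad: "config_of n1 n2 n3 n4 \<in> set bad_configs"
    have "config_of 0 0 0 0 \<notin> set bad_configs"
      by (simp add: config_of_def occ_diff_def bad_configs_def)
    then have pos: "n1 + n2 + n3 + n4 > 0" using bad by (cases "n1 + n2 + n3 + n4 = 0") auto
    obtain m1 m2 m3 m4 where m: "config_of m1 m2 m3 m4 \<in> set (parent_configs (config_of n1 n2 n3 n4))"
      "m1 + m2 + m3 + m4 < n1 + n2 + n3 + n4"
      using config_of_parent pos by metis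
    have "config_of m1 m2 m3 m4 \<in> set bad_configs"
      using bad_closed bad m(1) feasible_config_of[of m1 m2 m3 m4]
      unfolding closed_under_parents_def list_all_iff List.member_iff by (metis (full_types))
    then show False using less[OF m(2)] by blast
  qed
qed

lemma balanced_2:
  assumes n: "n1 + n2 = n3 + n4"
  shows "occ 2 M n1 + occ 2 M n2 \<le> occ 2 M n3 + occ 2 M n4 + 2"
proof (rule ccontr)
  let ?x = "occ_diff L n1 n2 n3 n4" and ?y = "occ_diff S n1 n2 n3 n4"
    and ?w = "occ_diff M n1 n2 n3 n4"
  assume "\<not> ?thesis"
  then have w: "?w \<ge> 3" by (simp add: occ_diff_def)
  have x: "?x = - ?y - ?w"
    using n occ_sum[of 2 n1] occ_sum[of 2 n2] occ_sum[of 2 n3] occ_sum[of 2 n4]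
    unfolding occ_diff_def by linarith
  have feas: "feasible ((- ?y - ?w, ?y, ?w), (u 2 n1, u 2 n2), (u 2 n3, u 2 n4))"
    using feasible_config_of[of n1 n2 n3 n4] by (simp only: config_of_def x)
  have fu: "fst (freq_up a) \<le> 1" "snd (freq_up a) \<le> 5" "fst (freq_lo a) \<le> 9" "snd (freq_lo a) = 1"
    "fst (aux_up a) \<le> 3" "snd (aux_up a) = 0" "fst (aux_lo a) \<le> 1" "snd (aux_lo a) \<ge> - 1"
    "fst (aux_lo a) + snd (aux_lo a) \<le> 0" for a
    by (cases a; simp)+
  \<comment> \<open>The first functional gives \<open>(7 + z) w <= 20 + 12 z\<close> with
    \<open>z < 0.3\<close>.\<close>
  have w3: "?w = 3"
    using feas w fu[of "u 2 n1"] fu[of "u 2 n2"] fu[of "u 2 n3"] fu[of "u 2 n4"]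
    by (simp add: may_le_def Let_def min_def split: if_splits)
  \<comment> \<open>Now the second functional equals \<open>- 3 y - 3 + 3 b\<close>, so its bounds
    enclose \<open>y\<close>.\<close>
  have "- 3 \<le> ?y" "?y \<le> 1"
    using feas w3 fu[of "u 2 n1"] fu[of "u 2 n2"] fu[of "u 2 n3"] fu[of "u 2 n4"]
    by (simp_all add: may_le_def Let_def min_def split: if_splits)
  then have y: "?y \<in> set [- 3, - 2, - 1, 0, 1]" by auto
  have l: "a \<in> set [L, S, M]" for a by (cases a) auto
  have "List.member bad_configs ((- ?y - 3, ?y, 3), (u 2 n1, u 2 n2), (u 2 n3, u 2 n4))"
    using bad_initial feas y l unfolding list_all_iff Let_def w3 by (metis (full_types))
  then have "config_of n1 n2 n3 n4 \<in> set bad_configs"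
    by (simp add: config_of_def x w3 List.member_iff)
  then show False using config_of_not_bad by blast
qed

section \<open>From prefixes to factors\<close>

theorem theorem4p1:
  fixes p :: nat and v w :: "letter list"
  assumes "p > 1"
    and "is_factor p v" and "is_factor p w"
    and "length v = length w"
  shows "\<bar>int (count_letter v M) - int (count_letter w M)\<bar> \<le> 2"
proof -
  have balanced: "occ p M n1 + occ p M n2 \<le> occ p M n3 + occ p M n4 + 2"
    if "n1 + n2 = n3 + n4" for n1 n2 n3 n4
    using that balanced_2 balanced_ge_3 assms(1) by (cases "p = 2") auto
  obtain k where k: "v = map (u p) [k..<k + length v]"
    using assms(2) by (auto simp: is_factor_def)
  obtain l where l: "w = map (u p) [l..<l + length w]"
    using assms(3) by (auto simp: is_factor_def)
  \<comment> \<open>The end of one factor is paired with the start of the other, which makes the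
    length sums agree; the two choices give both signs.\<close>
  show ?thesis
    using balanced[of "k + length v" l k "l + length w"] balanced[of k "l + length w" "k + length v" l]
      count_letter_factor[OF k, of M] count_letter_factor[OF l, of M] assms(4)
    by simp
qed

end
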